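(* For every integer $n\ge0$, every real $y$ and every real $x$ with $1+\lambda x>0$, \[ B_{n,\lambda}(x,y)=\frac{1}{e_\lambda(x)}(XD)_{n,\lambda}\,e^{y}_\lambda(x), \] where $e_\lambda^y(x)=(1+\lambda x)^{y/\lambda}$ is regarded as a function of $x$.
   Context: Let $\lambda$ be a fixed nonzero real number. The degenerate falling factorial is $(x)_{0,\lambda}=1$ and $(x)_{n,\lambda}=x(x-\lambda)\cdots(x-(n-1)\lambda)$ for $n\ge1$. The degenerate exponential is $e_\lambda^{x}(t)=(1+\lambda t)^{x/\lambda}=\sum_{n\ge0}(x)_{n,\lambda}\frac{t^n}{n!}$, and $e_\lambda(t)=e_\lambda^1(t)$. For real $x,y$ with $1+\lambda x>0$, the two variable fully degenerate Bell polynomials $B_{n,\lambda}(x,y)$ are defined by the formal power series identity in $t$ \[ \frac{1}{e_\lambda(x)}\,e^{y}_\lambda\big(xe_\lambda(t)\big)=\sum_{n\ge0}B_{n,\lambda}(x,y)\frac{t^n}{n!},\qquad e_\lambda^{y}(xe_\lambda(t))=(1+\lambda x e_\lambda(t))^{y/\lambda}. \] On smooth functions of $x$ (on the interval $1+\lambda x>0$), $X$ denotes multiplication by $x$, $D=\frac{d}{dx}$, and $(XD)_{n,\lambda}=\prod_{i=0}^{n-1}(XD-i\lambda)$ (the identity for $n=0$). *)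

theory Defs
  imports "HOL-Analysis.Analysis"
begin

definition degen_ffact :: "real \<Rightarrow> real \<Rightarrow> nat \<Rightarrow> real" where
  "degen_ffact lam x n = (\<Prod>i<n. x - real i * lam)"

definition degen_exp :: "real \<Rightarrow> real \<Rightarrow> real \<Rightarrow> real" where
  "degen_exp lam y x = (1 + lam * x) powr (y / lam)"

(* Real power of a formal power series f with constant term c > 0:
   f^a = c^a (1 + (f/c - 1))^a, expanded by the binomial series. *)
definition fps_rpow :: "real fps \<Rightarrow> real \<Rightarrow> real fps" where
  "fps_rpow f a =
     fps_const (fps_nth f 0 powr a) *
     (fps_binomial a oo (fps_const (inverse (fps_nth f 0)) * f - 1))"

(* e_lam^y(F(t)) = (1 + lam F(t))^(y/lam) as a formal power series in t,
   where 1 + lam F(0) > 0; e_lam(t) itself is the case F = fps_X, y = 1. *)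
definition degen_exp_fps :: "real \<Rightarrow> real \<Rightarrow> real fps \<Rightarrow> real fps" where
  "degen_exp_fps lam y F = fps_rpow (1 + fps_const lam * F) (y / lam)"

lemma fps_rpow_of_nat:
  assumes "fps_nth f 0 > 0"
  shows "fps_rpow f (real k) = f ^ k"
proof -
  let ?c = "fps_nth f 0"
  have "fps_binomial (real k) oo (fps_const (inverse ?c) * f - 1) = (fps_const (inverse ?c) * f) ^ k"
    using assms by (simp add: fps_binomial_of_nat fps_compose_add_distrib flip: fps_compose_power)
  moreover have "fps_const (?c ^ k) * (fps_const (inverse ?c) * f) ^ k = f ^ k"
    using assms
    by (simp add: fps_const_power mult.assoc[symmetric] flip: power_mult_distrib fps_const_power)
  ultimately show ?thesis
    using assms by (simp add: fps_rpow_def powr_realpow)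
qed

lemma degen_exp_fps_X:
  assumes "lam \<noteq> 0"
  shows "degen_exp_fps lam y fps_X = Abs_fps (\<lambda>n. degen_ffact lam y n / fact n)"
proof (rule fps_ext)
  fix n
  have "lam ^ n * (\<Prod>i = 0..<n. y / lam - real i) = (\<Prod>i = 0..<n. lam * (y / lam - real i))"
    by (simp add: prod.distrib)
  also have "\<dots> = degen_ffact lam y n"
    unfolding degen_ffact_def lessThan_atLeast0 using assms
    by (intro prod.cong) (auto simp: field_simps)
  finally have "lam ^ n * (y / lam gchoose n) = degen_ffact lam y n / fact n"
    by (simp add: gbinomial_prod_rev field_simps)
  then show "fps_nth (degen_exp_fps lam y fps_X) n = fps_nth (Abs_fps (\<lambda>n. degen_ffact lam y n / fact n)) n"
    by (simp add: degen_exp_fps_def fps_rpow_def fps_compose_linear)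
qed

definition degen_bell :: "real \<Rightarrow> nat \<Rightarrow> real \<Rightarrow> real \<Rightarrow> real" where
  "degen_bell lam n x y =
     fact n * fps_nth (fps_const (1 / degen_exp lam 1 x) *
       degen_exp_fps lam y (fps_const x * degen_exp_fps lam 1 fps_X)) n"

lemma degen_bell_egf:
  "fps_const (1 / degen_exp lam 1 x) *
     degen_exp_fps lam y (fps_const x * degen_exp_fps lam 1 fps_X) =
   Abs_fps (\<lambda>n. degen_bell lam n x y / fact n)"
  by (simp add: fps_eq_iff degen_bell_def)

definition XD :: "(real \<Rightarrow> real) \<Rightarrow> real \<Rightarrow> real" where
  "XD f = (\<lambda>x. x * deriv f x)"

(* Functions on the open interval 1 + lam * x > 0 are represented by total functions;
   as deriv is local, values outside the interval do not affect the result inside it.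
   The factors commute on smooth functions; the factor with i = 0 is applied first. *)
primrec XD_ffact :: "real \<Rightarrow> nat \<Rightarrow> (real \<Rightarrow> real) \<Rightarrow> real \<Rightarrow> real" where
  "XD_ffact lam 0 f = f"
| "XD_ffact lam (Suc n) f =
     (\<lambda>x. XD (XD_ffact lam n f) x - real n * lam * XD_ffact lam n f x)"

end

theory Submission
  imports Defs
begin

text \<open>
  Write \<open>E = e\<^sub>\<lambda>(t)\<close>, \<open>a = y / \<lambda>\<close> and \<open>w = \<lambda>x / (1 + \<lambda>x)\<close>. Since \<open>1 + \<lambda>xE = (1 + \<lambda>x)(1 + w(E - 1))\<close>,
  the coefficient of \<open>t\<^sup>n\<close> in \<open>(1 + \<lambda>xE)\<^sup>a\<close> is the finite sum over \<open>k\<close> of \<open>h\<^sub>k(x)\<close> times the coefficient of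
  \<open>t\<^sup>n\<close> in \<open>(E - 1)\<^sup>k\<close>, where \<open>h\<^sub>k = (1 + \<lambda>x)\<^sup>a (a gchoose k) w\<^sup>k\<close>. From \<open>(1 + \<lambda>t) E' = E\<close> and
  \<open>XD h\<^sub>k = k h\<^sub>k + (k + 1) h\<^sub>k\<^sub>+\<^sub>1\<close> it follows that passing from \<open>n\<close> to \<open>n + 1\<close> amounts, up to the
  factorial, to applying \<open>XD - n\<lambda>\<close>.
\<close>

abbreviation degen_exp_fps_1 :: "real \<Rightarrow> real fps" where
  "degen_exp_fps_1 lam \<equiv> degen_exp_fps lam 1 fps_X"

lemma degen_exp_fps_1_nth_0 [simp]:
  assumes "lam \<noteq> 0"
  shows "fps_nth (degen_exp_fps_1 lam) 0 = 1"
  using assms by (simp add: degen_exp_fps_X degen_ffact_def)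

text \<open>Comparing coefficients reduces this to the recurrence \<open>degen_ffact lam 1 (Suc m) =
  (1 - m * lam) * degen_ffact lam 1 m\<close>.\<close>

lemma degen_exp_fps_1_deriv:
  assumes "lam \<noteq> 0"
  shows "(1 + fps_const lam * fps_X) * fps_deriv (degen_exp_fps_1 lam) = degen_exp_fps_1 lam"
proof (rule fps_ext)
  fix n
  have step: "real (Suc m) * (degen_ffact lam 1 (Suc m) / fact (Suc m)) =
      (1 - real m * lam) * (degen_ffact lam 1 m / fact m)" for m
    by (simp add: degen_ffact_def field_simps del: of_nat_Suc)
  show "fps_nth ((1 + fps_const lam * fps_X) * fps_deriv (degen_exp_fps_1 lam)) n =
      fps_nth (degen_exp_fps_1 lam) n"
  proof (cases n)
    case 0
    then show ?thesis
      using assms by (simp add: degen_exp_fps_X degen_ffact_def distrib_right mult.assoc)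
  next
    case (Suc m)
    then show ?thesis
      using assms step[of n]
      by (simp add: degen_exp_fps_X distrib_right mult.assoc right_diff_distrib diff_divide_distrib mult_ac
          del: of_nat_Suc fact_Suc)
  qed
qed

text \<open>Up to the factor \<open>k! / n!\<close>, these are the degenerate Stirling numbers of
  the second kind.\<close>

definition degen_coeff :: "real \<Rightarrow> nat \<Rightarrow> nat \<Rightarrow> real" where
  "degen_coeff lam n k = fps_nth ((degen_exp_fps_1 lam - 1) ^ k) n"

lemma degen_coeff_0_right: "degen_coeff lam n 0 = (if n = 0 then 1 else 0)"
  by (simp add: degen_coeff_def)

lemma degen_coeff_eq_0:
  assumes "lam \<noteq> 0" "n < k"
  shows "degen_coeff lam n k = 0"
  unfolding degen_coeff_def using assms by (intro startsby_zero_power_prefix[rule_format]) auto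

text \<open>Apply \<open>(1 + lam t) d/dt\<close> to the power \<open>F ^ Suc k\<close> with
  \<open>F = E - 1\<close>. The differential equation turns the inner derivative into
  \<open>F + 1\<close>, so only the powers \<open>Suc k\<close> and \<open>k\<close> occur.\<close>

lemma degen_coeff_Suc_Suc:
  assumes "lam \<noteq> 0"
  shows "real (Suc n) * degen_coeff lam (Suc n) (Suc k) =
    (real (Suc k) - real n * lam) * degen_coeff lam n (Suc k) + real (Suc k) * degen_coeff lam n k"
proof -
  define F where "F = degen_exp_fps_1 lam - 1"
  have F: "(1 + fps_const lam * fps_X) * fps_deriv F = F + 1"
    using degen_exp_fps_1_deriv[OF assms] by (simp add: F_def)
  have "(1 + fps_const lam * fps_X) * fps_deriv (F ^ Suc k) =
      fps_const (real (Suc k)) * ((1 + fps_const lam * fps_X) * fps_deriv F) * F ^ k"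
    by (simp add: fps_deriv_power mult_ac del: power_Suc of_nat_Suc)
  also have "\<dots> = fps_const (real (Suc k)) * (F ^ Suc k + F ^ k)"
    unfolding F by (simp add: algebra_simps del: of_nat_Suc)
  finally have "fps_nth ((1 + fps_const lam * fps_X) * fps_deriv (F ^ Suc k)) n =
      fps_nth (fps_const (real (Suc k)) * (F ^ Suc k + F ^ k)) n"
    by simp
  moreover have "fps_nth ((1 + fps_const lam * fps_X) * fps_deriv (F ^ Suc k)) n =
      real (Suc n) * fps_nth (F ^ Suc k) (Suc n) + lam * real n * fps_nth (F ^ Suc k) n"
    by (cases n) (simp_all add: distrib_right mult.assoc del: power_Suc of_nat_Suc)
  ultimately show ?thesis
    by (simp add: degen_coeff_def F_def[symmetric] algebra_simps del: power_Suc of_nat_Suc)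
qed

text \<open>Where \<open>1 + lam * x > 0\<close>, this is \<open>x ^ k / k!\<close> times the
  \<open>k\<close>-th derivative of \<open>(1 + lam * x) powr a\<close>.\<close>

definition degen_term :: "real \<Rightarrow> real \<Rightarrow> nat \<Rightarrow> real \<Rightarrow> real" where
  "degen_term lam a k x = (1 + lam * x) powr a * (a gchoose k) * (lam * x / (1 + lam * x)) ^ k"

text \<open>With \<open>w = lam * x / (1 + lam * x)\<close>, the operator \<open>XD\<close>
  multiplies the power with exponent \<open>a\<close> by \<open>a * w\<close> and
  \<open>w ^ k\<close> by \<open>k * (1 - w)\<close>. The sum of these factors is
  \<open>k + (a - k) * w\<close>, and \<open>a - k\<close> is absorbed into the next binomial
  coefficient.\<close>

lemma degen_term_has_derivative:
  assumes "1 + lam * x > 0"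
  shows "\<exists>d. (degen_term lam a k has_real_derivative d) (at x) \<and>
    x * d = real k * degen_term lam a k x + real (Suc k) * degen_term lam a (Suc k) x"
proof -
  define u where "u = 1 + lam * x"
  define w where "w = lam * x / u"
  define d where "d = a * lam / u * u powr a * (a gchoose k) * w ^ k +
    u powr a * (a gchoose k) * (real k * w ^ (k - 1) * (lam / u\<^sup>2))"
  have u: "u > 0" using assms by (simp add: u_def)
  have w': "((\<lambda>x. lam * x / (1 + lam * x)) has_real_derivative lam / u\<^sup>2) (at x)"
    using u unfolding u_def
    by (auto intro!: derivative_eq_intros simp: field_simps power2_eq_square)
  have p': "((\<lambda>x. (1 + lam * x) powr a) has_real_derivative a * lam / u * u powr a) (at x)"
    using u unfolding u_def
    by (auto intro!: derivative_eq_intros simp: field_simps powr_diff)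
  have "(degen_term lam a k has_real_derivative d) (at x)"
    unfolding degen_term_def d_def
    by (rule DERIV_cong, rule DERIV_mult[OF DERIV_cmult_right[OF p'] DERIV_power[OF w']])
      (simp add: u_def w_def)
  moreover have "x * d = real k * degen_term lam a k x + real (Suc k) * degen_term lam a (Suc k) x"
  proof -
    have x1: "x * (lam / u\<^sup>2) = w * (1 - w)"
      using u unfolding w_def by (simp add: field_simps power2_eq_square) (simp add: u_def algebra_simps)
    have "real k * (x * (w ^ (k - 1) * (lam / u\<^sup>2))) = real k * w ^ (k - 1) * (x * (lam / u\<^sup>2))"
      by simp
    \<comment> \<open>At \<open>k = 0\<close> the truncated exponent \<open>k - 1\<close> is
      harmless, since the factor \<open>real k\<close> vanishes.\<close>
    also have "\<dots> = real k * (1 - w) * w ^ k"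
      unfolding x1 by (cases k) auto
    finally have x2: "real k * (x * (w ^ (k - 1) * (lam / u\<^sup>2))) = real k * (1 - w) * w ^ k" .
    have "x * d = u powr a * (a gchoose k) * w ^ k * (a * w) +
        u powr a * (a gchoose k) * (real k * (x * (w ^ (k - 1) * (lam / u\<^sup>2))))"
      by (simp add: d_def w_def algebra_simps)
    also have "\<dots> = real k * (u powr a * (a gchoose k) * w ^ k) +
        u powr a * ((a - real k) * (a gchoose k)) * w ^ Suc k"
      unfolding x2 by (simp add: algebra_simps)
    also have "(a - real k) * (a gchoose k) = real (Suc k) * (a gchoose Suc k)"
      using gbinomial_mult_1[of a k] by (simp add: algebra_simps)
    finally show ?thesis
      by (simp add: degen_term_def u_def w_def mult_ac)
  qed
  ultimately show ?thesis by blast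
qed

text \<open>\<open>fps_rpow\<close> splits off the constant term \<open>1 + lam * x\<close>. The
  series left inside the binomial has zero constant term, so its powers beyond \<open>n\<close> do
  not reach the coefficient of index \<open>n\<close>.\<close>

lemma degen_exp_fps_nth:
  assumes "lam \<noteq> 0" "1 + lam * x > 0"
  shows "fps_nth (degen_exp_fps lam y (fps_const x * degen_exp_fps_1 lam)) n =
    (\<Sum>k\<le>n. degen_coeff lam n k * degen_term lam (y / lam) k x)"
proof -
  define E where "E = degen_exp_fps_1 lam"
  let ?f = "1 + fps_const lam * (fps_const x * E)"
  have E0: "fps_nth E 0 = 1"
    using assms by (simp add: E_def)
  then have f0: "fps_nth ?f 0 = 1 + lam * x"
    by simp
  have "fps_const (inverse (1 + lam * x)) * ?f - 1 =
      fps_const (lam * x / (1 + lam * x)) * (E - 1)"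
  proof (rule fps_ext)
    fix m
    show "fps_nth (fps_const (inverse (1 + lam * x)) * ?f - 1) m =
        fps_nth (fps_const (lam * x / (1 + lam * x)) * (E - 1)) m"
      using assms E0 by (cases "m = 0") (simp_all add: field_simps)
  qed
  then show ?thesis
    unfolding E_def[symmetric] degen_coeff_def degen_exp_fps_def[of _ _ "fps_const x * E"] fps_rpow_def f0
    by (simp add: fps_compose_nth power_mult_distrib fps_const_power sum_distrib_left
        degen_term_def atLeast0AtMost mult_ac)
qed

lemma XD_ffact_degen_exp:
  assumes lam: "lam \<noteq> 0" and "1 + lam * x > 0"
  shows "XD_ffact lam n (degen_exp lam y) x =
    fact n * (\<Sum>k\<le>n. degen_coeff lam n k * degen_term lam (y / lam) k x)"
  using assms(2)
proof (induction n arbitrary: x)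
  case 0
  then show ?case by (simp add: degen_coeff_0_right degen_term_def degen_exp_def)
next
  case (Suc n)
  let ?h = "degen_term lam (y / lam)" and ?c = "degen_coeff lam"
  obtain d where d: "\<And>k. (?h k has_real_derivative d k) (at x)"
    "\<And>k. x * d k = real k * ?h k x + real (Suc k) * ?h (Suc k) x"
    using degen_term_has_derivative[OF Suc.prems, of "y / lam"] by metis
  \<comment> \<open>The induction hypothesis holds at every point of this set. Its openness lets the
    derivative of the explicit sum pass to \<open>XD_ffact\<close>.\<close>
  have "open {u. 1 + lam * u > 0}"
    by (intro open_Collect_less continuous_intros)
  moreover have "((\<lambda>u. fact n * (\<Sum>k\<le>n. ?c n k * ?h k u)) has_real_derivative
      fact n * (\<Sum>k\<le>n. ?c n k * d k)) (at x)"
    by (intro DERIV_cmult DERIV_sum d)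
  ultimately have "(XD_ffact lam n (degen_exp lam y) has_real_derivative
      fact n * (\<Sum>k\<le>n. ?c n k * d k)) (at x)"
    using Suc.prems Suc.IH
    by (elim has_field_derivative_transform_within_open) auto
  then have "XD_ffact lam (Suc n) (degen_exp lam y) x =
      x * (fact n * (\<Sum>k\<le>n. ?c n k * d k)) - real n * lam * (fact n * (\<Sum>k\<le>n. ?c n k * ?h k x))"
    using Suc.IH[OF Suc.prems] by (simp add: XD_def DERIV_imp_deriv)
  also have "\<dots> = fact n * (\<Sum>k\<le>n. ?c n k * (x * d k) - real n * lam * ?c n k * ?h k x)"
    by (simp add: sum_subtractf sum_distrib_left right_diff_distrib mult_ac)
  also have "(\<Sum>k\<le>n. ?c n k * (x * d k) - real n * lam * ?c n k * ?h k x) =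
      (\<Sum>k\<le>n. (real k - real n * lam) * ?c n k * ?h k x) +
      (\<Sum>k\<le>n. real (Suc k) * ?c n k * ?h (Suc k) x)"
    unfolding d(2) by (simp add: sum.distrib[symmetric] algebra_simps)
  \<comment> \<open>The added term is zero because \<open>degen_coeff lam n (Suc n) = 0\<close>; it
    makes the index shift end at \<open>n\<close>.\<close>
  also have "(\<Sum>k\<le>n. (real k - real n * lam) * ?c n k * ?h k x) =
      (\<Sum>k\<le>Suc n. (real k - real n * lam) * ?c n k * ?h k x)"
    using lam by (simp add: degen_coeff_eq_0)
  \<comment> \<open>The term at \<open>k = 0\<close> drops out: either \<open>n = 0\<close> or
    \<open>degen_coeff lam n 0 = 0\<close>.\<close>
  also have "\<dots> = (\<Sum>k\<le>n. (real (Suc k) - real n * lam) * ?c n (Suc k) * ?h (Suc k) x)"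
    unfolding sum.atMost_Suc_shift by (simp add: degen_coeff_0_right)
  also have "\<dots> + (\<Sum>k\<le>n. real (Suc k) * ?c n k * ?h (Suc k) x) =
      (\<Sum>k\<le>n. real (Suc n) * ?c (Suc n) (Suc k) * ?h (Suc k) x)"
    unfolding degen_coeff_Suc_Suc[OF lam]
    by (simp add: sum.distrib[symmetric] distrib_right del: of_nat_Suc)
  also have "\<dots> = real (Suc n) * (\<Sum>k\<le>Suc n. ?c (Suc n) k * ?h k x)"
    unfolding sum.atMost_Suc_shift
    by (simp add: degen_coeff_0_right sum_distrib_left mult.assoc del: of_nat_Suc)
  finally show ?case
    by (simp only: fact_Suc mult_ac)
qed

theorem theorem2p7:
  fixes lam x y :: real and n :: nat
  assumes "lam \<noteq> 0"
    and "1 + lam * x > 0"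
  shows "degen_bell lam n x y =
    1 / degen_exp lam 1 x * XD_ffact lam n (\<lambda>u. degen_exp lam y u) x"
  using assms by (simp add: degen_bell_def degen_exp_fps_nth XD_ffact_degen_exp)

end
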